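(* Fix $k\ge2$. Assume $q_i>0$ for all $i\in\mathbb{N}$ and $\mathbb{E} Z=\infty$. Then, in the $k$-choice model, with probability one, $L_n\to-\infty$ as $n\to\infty$.
   Context: Let $Z$ be a random variable on $\mathbb{N}=\{1,2,3,\dots\}$ with $q_i=\mathbb{P}(Z=i)$. Fix $k\ge2$ and let $(Z^{(1)}_n)_{n\ge1},\dots,(Z^{(k)}_n)_{n\ge1}$ be $k$ independent sequences of i.i.d. random variables, all distributed as $Z$ and mutually independent. The $k$-choice model: define $T_n=\{n\}$ for $n\le0$ and $T_n=\{n\}\cup\bigcup_{i=1}^k T_{n-Z^{(i)}_n}$ for $n\ge1$. Let $\mathcal{L}_n=T_n\cap\{0,-1,-2,\dots\}$, $R_n=\max\mathcal{L}_n$, $L_n=\min\mathcal{L}_n$, $\Lambda_n=|\mathcal{L}_n|$. *)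

theory Defs
  imports "HOL-Probability.Probability"
begin

text \<open>The k-choice model.  A realization of the random inputs is a function
  z :: nat => nat => nat, where z i m is the value of Z^(i+1)_m (choices indexed by
  i < k, times m >= 1).  The set T_n is defined by the paper's recursion
  T_n = {n} for n <= 0 and T_n = {n} union the union over i < k of T_(n - z i n).
  Since Z takes values in {1,2,...}, the guard z i n > 0 holds almost surely; it is
  only there to make the recursion total.\<close>

function Tset :: "nat \<Rightarrow> (nat \<Rightarrow> nat \<Rightarrow> nat) \<Rightarrow> int \<Rightarrow> int set" where
  "Tset k z n =
     (if n \<le> 0 then {n}
      else {n} \<union> (\<Union>i\<in>{i. i < k \<and> 0 < z i (nat n)}. Tset k z (n - int (z i (nat n)))))"
  by auto
termination
  by (relation "Wellfounded.measure (\<lambda>(k, z, n). nat n)") auto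

definition Lset :: "nat \<Rightarrow> (nat \<Rightarrow> nat \<Rightarrow> nat) \<Rightarrow> int \<Rightarrow> int set" where
  "Lset k z n = Tset k z n \<inter> {..0}"

definition Rmax :: "nat \<Rightarrow> (nat \<Rightarrow> nat \<Rightarrow> nat) \<Rightarrow> int \<Rightarrow> int" where
  "Rmax k z n = Max (Lset k z n)"

definition Lmin :: "nat \<Rightarrow> (nat \<Rightarrow> nat \<Rightarrow> nat) \<Rightarrow> int \<Rightarrow> int" where
  "Lmin k z n = Min (Lset k z n)"

end

(*
  Fix c and call a site confined if its tree contains nothing below -c. Shift all sites by c, so
  that the confined ones are natural numbers; let b(m) indicate that m is confined, and let
  x(m) = sum over g < m of q(m - g) b(g) be the conditional probability given the past that one step
  from m lands on a confined site; m > c is confined with conditional probability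
  x(m)^k <= x(m)^2. The weighted count W(m) = sum over g <= m of P(Z > m - g) b(g) has increment
  b(m) - x(m), so it is a nonnegative supermartingale whose total expected decrease is at
  least sum E x(m)(1 - x(m)); hence x(m)(1 - x(m)) -> 0 almost surely. If m is confined and m + 1 is
  not, then q(2) <= x(m + 2) <= 1 - q(1), which can happen only finitely often; so b is eventually
  constant. It cannot be eventually 1 with positive probability, since then W(m) would grow
  like the partial sums of sum P(Z > j) = E Z = infinity.
*)

theory Submission
  imports Defs
begin

section \<open>Elementary properties of the trees\<close>

declare Tset.simps [simp del]

lemma Tset_nonpos: "n \<le> 0 \<Longrightarrow> Tset k z n = {n}"
  by (subst Tset.simps) simp

lemma Tset_pos:
  "n > 0 \<Longrightarrow> Tset k z n =
     insert n (\<Union>i\<in>{i. i < k \<and> 0 < z i (nat n)}. Tset k z (n - int (z i (nat n))))"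
  by (subst Tset.simps) simp

text \<open>The recursion reads only times from 1 to \<open>n\<close>. So confinement of a site is
  determined by finitely many inputs, which later gives both measurability and independence.\<close>

lemma Tset_cong:
  assumes "\<And>i m. i < k \<Longrightarrow> 1 \<le> m \<Longrightarrow> int m \<le> n \<Longrightarrow> z i m = z' i m"
  shows "Tset k z n = Tset k z' n"
  using assms
proof (induction k z n rule: Tset.induct)
  case (1 k z n)
  show ?case
  proof (cases "n \<le> 0")
    case True
    then show ?thesis by (simp add: Tset_nonpos)
  next
    case False
    have eq: "z i (nat n) = z' i (nat n)" if "i < k" for i
      using False that by (intro 1(2)) auto
    have "Tset k z (n - int (z i (nat n))) = Tset k z' (n - int (z i (nat n)))"
      if "i < k" "0 < z i (nat n)" for i
      using False that by (intro 1(1)) (auto intro!: 1(2))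
    with False eq show ?thesis
      by (simp add: Tset_pos cong: conj_cong)
  qed
qed

lemma finite_Tset: "finite (Tset k z n)"
proof (induction k z n rule: Tset.induct)
  case (1 k z n)
  then show ?case
    by (subst Tset.simps) auto
qed

text \<open>Members of the tree above 0 are invisible to \<open>Lmin\<close>; they respect the bound
  because \<open>c\<close> is at most 0.\<close>

lemma Tset_subset_if_Lmin_ge:
  assumes "c \<le> Lmin k z n" "c \<le> 0"
  shows "Tset k z n \<subseteq> {c..}"
proof
  fix t assume t: "t \<in> Tset k z n"
  show "t \<in> {c..}"
  proof (cases "t \<le> 0")
    case True
    with t have "t \<in> Lset k z n" by (simp add: Lset_def)
    moreover have "finite (Lset k z n)" by (simp add: Lset_def finite_Tset)
    ultimately show ?thesis
      using assms(1) unfolding Lmin_def by (auto dest: Min_le)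
  qed (use assms(2) in auto)
qed

section \<open>Tails of the step law, and a deterministic 0-1 alternative\<close>

text \<open>Layer-cake formula: x is the number of j < x, so by monotone convergence the mean is the
  sum of the tails.\<close>

lemma sums_measure_gt_infinite:
  fixes p :: "nat pmf"
  assumes "(\<integral>\<^sup>+ x. ennreal (real x) \<partial>measure_pmf p) = \<infinity>"
  shows "filterlim (\<lambda>N. \<Sum>j<N. measure (measure_pmf p) {j<..}) at_top sequentially"
proof -
  let ?Q = "\<lambda>j. measure (measure_pmf p) {j<..}"
  have "(\<Sum>j. indicator {j<..} x) = ennreal (real x)" for x :: nat
  proof -
    have "(\<Sum>j. indicator {j<..} x :: ennreal) = (\<Sum>j\<in>{..<x}. indicator {j<..} x)"
      by (intro suminf_finite) auto
    also have "\<dots> = (\<Sum>j\<in>{..<x}. 1)" by (intro sum.cong) auto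
    finally show ?thesis by (simp add: ennreal_of_nat_eq_real_of_nat)
  qed
  then have "(\<integral>\<^sup>+ x. ennreal (real x) \<partial>measure_pmf p)
      = (\<integral>\<^sup>+ x. (\<Sum>j. indicator {j<..} x) \<partial>measure_pmf p)"
    by simp
  also have "\<dots> = (\<Sum>j. ennreal (?Q j))"
    by (subst nn_integral_suminf) (auto simp: measure_pmf.emeasure_eq_measure)
  finally have inf: "(\<Sum>j. ennreal (?Q j)) = \<infinity>" using assms by simp
  have "\<not> summable ?Q"
  proof
    assume "summable ?Q"
    then have "(\<Sum>j. ennreal (?Q j)) \<noteq> \<infinity>"
      by (subst suminf_ennreal2) auto
    with inf show False by simp
  qed
  show ?thesis
  proof (subst filterlim_at_top, intro allI)
    fix C :: real
    have "\<exists>N. C \<le> (\<Sum>j<N. ?Q j)"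
    proof (rule ccontr)
      assume "\<not> ?thesis"
      then have "summable ?Q"
        by (intro summableI_nonneg_bounded[where x = C]) (auto simp: not_le less_imp_le)
      with \<open>\<not> summable ?Q\<close> show False by simp
    qed
    then obtain N where N: "C \<le> (\<Sum>j<N. ?Q j)" by blast
    have "C \<le> (\<Sum>j<M. ?Q j)" if "M \<ge> N" for M
      using that by (intro order_trans[OF N] sum_mono2) auto
    then show "eventually (\<lambda>N. C \<le> (\<Sum>j<N. ?Q j)) sequentially"
      by (auto simp: eventually_sequentially)
  qed
qed

text \<open>Applied to one realization at a time. Past some \<open>N\<close>, truth of
  \<open>b\<close> passes from each index to the next, so one true index there would contradict
  \<open>inf\<close>.\<close>

lemma eventually_not_if_step_degenerate:
  fixes b :: "nat \<Rightarrow> bool" and p :: "nat pmf"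
  defines "x \<equiv> \<lambda>m. \<Sum>g<m. pmf p (m - g) * of_bool (b g)"
  assumes lim: "(\<lambda>m. x m * (1 - x m)) \<longlonglongrightarrow> 0"
    and pos: "pmf p 1 > 0" "pmf p 2 > 0"
    and inf: "\<And>N. \<exists>m\<ge>N. \<not> b m"
  shows "eventually (\<lambda>m. \<not> b m) sequentially"
proof -
  define e where "e = pmf p 1 * pmf p 2"
  have "e > 0" using pos by (simp add: e_def)
  with lim have "eventually (\<lambda>m. x m * (1 - x m) < e) sequentially"
    by (auto dest: order_tendstoD(2))
  then obtain N where N: "\<And>m. m \<ge> N \<Longrightarrow> x m * (1 - x m) < e"
    by (auto simp: eventually_sequentially)
  have stay: "b (Suc m)" if "m \<ge> N" "b m" for m
  proof (rule ccontr)
    assume not: "\<not> b (Suc m)"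
    \<comment> \<open>The site \<open>m\<close> is reached from \<open>m + 2\<close> by a step of
      length 2.\<close>
    have "pmf p 2 * of_bool (b m) \<le> x (Suc (Suc m))"
      unfolding x_def by (rule order_trans[OF _ member_le_sum[of m]]) (auto simp: numeral_2_eq_2)
    then have lo: "pmf p 2 \<le> x (Suc (Suc m))" using that by simp
    \<comment> \<open>The summand of \<open>Suc m\<close>, the one with step length 1, vanishes by
      \<open>not\<close>; the remaining step lengths are distinct and differ from 1.\<close>
    have "x (Suc (Suc m)) = (\<Sum>g<Suc m. pmf p (Suc (Suc m) - g) * of_bool (b g))"
      unfolding x_def sum.lessThan_Suc[of _ "Suc m"]
      by (simp only: not of_bool_eq mult_zero_right add_0_right)
    also have "\<dots> \<le> (\<Sum>g<Suc m. pmf p (Suc (Suc m) - g))"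
      by (intro sum_mono) auto
    also have "\<dots> = (\<Sum>j\<in>(\<lambda>g. Suc (Suc m) - g) ` {..<Suc m}. pmf p j)"
      by (subst sum.reindex) (auto simp: inj_on_def)
    also have "\<dots> = measure p ((\<lambda>g. Suc (Suc m) - g) ` {..<Suc m})"
      by (subst measure_measure_pmf_finite) auto
    also have "\<dots> \<le> measure p (UNIV - {1})"
      by (intro measure_pmf.finite_measure_mono) auto
    also have "\<dots> = 1 - pmf p 1"
      using measure_pmf.prob_compl[of "{1}" p] by (simp add: pmf.rep_eq)
    finally have "pmf p 1 \<le> 1 - x (Suc (Suc m))" by simp
    with lo have "e \<le> x (Suc (Suc m)) * (1 - x (Suc (Suc m)))"
      unfolding e_def using pos by (subst mult.commute) (intro mult_mono, auto)
    with N[of "Suc (Suc m)"] that show False by simp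
  qed
  have "\<not> b m" if "m \<ge> N" for m
  proof
    assume "b m"
    have "b n" if "n \<ge> m" for n
      using that by (induction n rule: dec_induct) (use \<open>b m\<close> \<open>m \<ge> N\<close> stay in auto)
    with inf show False by blast
  qed
  then show ?thesis by (auto simp: eventually_sequentially)
qed


section \<open>The supermartingale estimate\<close>

text \<open>The right side of \<open>step\<close> is the expectation of the square of
  \<open>x m\<close>, multiplied out. This lets the argument run on the expected weighted counts
  \<open>w m\<close>, without a filtration or conditional expectations.\<close>

lemma (in prob_space) AE_eventually_not_mem_if_quadratic_bound:
  fixes B :: "nat \<Rightarrow> 'a set" and p :: "nat pmf"
  assumes B[measurable]: "\<And>m. B m \<in> events"
    and p0: "pmf p 0 = 0" and p12: "pmf p 1 > 0" "pmf p 2 > 0"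
    and inf: "(\<integral>\<^sup>+ x. ennreal (real x) \<partial>measure_pmf p) = \<infinity>"
    and step: "\<And>m. m > c \<Longrightarrow>
      prob (B m) \<le> (\<Sum>g<m. \<Sum>h<m. pmf p (m - g) * pmf p (m - h) * prob (B g \<inter> B h))"
  shows "AE \<omega> in M. eventually (\<lambda>m. \<omega> \<notin> B m) sequentially"
proof -
  define Q where "Q j = measure (measure_pmf p) {j<..}" for j :: nat
  define x where "x m \<omega> = (\<Sum>g<m. pmf p (m - g) * of_bool (\<omega> \<in> B g))" for m \<omega>
  define y where "y m \<omega> = x m \<omega> * (1 - x m \<omega>)" for m \<omega>
  define w where "w m = (\<Sum>g\<le>m. Q (m - g) * prob (B g))" for m
  have Q_nonneg: "Q j \<ge> 0" for j by (simp add: Q_def)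
  have Q0: "Q 0 = 1"
  proof -
    have "Q 0 = measure p (UNIV - {0})"
      unfolding Q_def by (intro arg_cong[where f = "measure p"]) auto
    also have "\<dots> = 1"
      using measure_pmf.prob_compl[of "{0}" p] p0 by (simp add: pmf.rep_eq)
    finally show ?thesis .
  qed
  have Q_Suc: "Q j = pmf p (Suc j) + Q (Suc j)" for j
  proof -
    have "{j<..} = {Suc j} \<union> {Suc j<..}" by auto
    then have "Q j = measure p ({Suc j} \<union> {Suc j<..})" by (simp add: Q_def)
    also have "\<dots> = measure p {Suc j} + measure p {Suc j<..}"
      by (intro measure_pmf.finite_measure_Union) auto
    finally show ?thesis by (simp add: Q_def pmf.rep_eq)
  qed
  have w_nonneg: "w m \<ge> 0" for m
    unfolding w_def by (intro sum_nonneg mult_nonneg_nonneg Q_nonneg) auto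
  have x_nonneg: "x m \<omega> \<ge> 0" for m \<omega>
    unfolding x_def by (intro sum_nonneg) auto
  have x_le: "x m \<omega> \<le> 1" for m \<omega>
  proof -
    have "x m \<omega> \<le> (\<Sum>g<m. pmf p (m - g))"
      unfolding x_def by (intro sum_mono) auto
    also have "\<dots> = (\<Sum>j\<in>(\<lambda>g. m - g) ` {..<m}. pmf p j)"
      by (subst sum.reindex) (auto simp: inj_on_def)
    also have "\<dots> \<le> 1"
      by (subst measure_measure_pmf_finite[symmetric]) auto
    finally show ?thesis .
  qed
  have y_nonneg: "y m \<omega> \<ge> 0" for m \<omega>
    unfolding y_def using x_nonneg x_le by simp
  have ind: "of_bool (\<omega> \<in> A) = (indicator A \<omega> :: real)" for \<omega> A
    by (simp add: indicator_def)
  have x_meas[measurable]: "x m \<in> borel_measurable M" for m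
    unfolding x_def ind by measurable
  have y_meas[measurable]: "y m \<in> borel_measurable M" for m
    unfolding y_def by measurable
  have x_int: "integrable M (x m)" for m
    by (rule integrable_const_bound[where B = 1]) (use x_nonneg x_le in auto)
  have x2_int: "integrable M (\<lambda>\<omega>. x m \<omega> * x m \<omega>)" for m
    by (rule integrable_const_bound[where B = 1])
       (use x_nonneg x_le in \<open>auto simp: abs_mult intro!: mult_le_one\<close>)
  have y_eq: "y m = (\<lambda>\<omega>. x m \<omega> - x m \<omega> * x m \<omega>)" for m
    by (auto simp: y_def algebra_simps)
  have y_int: "integrable M (y m)" for m
    unfolding y_eq using x_int x2_int by (rule Bochner_Integration.integrable_diff)
  have Ex: "expectation (x m) = (\<Sum>g<m. pmf p (m - g) * prob (B g))" for m
    unfolding x_def ind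
    by (subst Bochner_Integration.integral_sum) (auto simp: less_top[symmetric])
  have Ex2: "expectation (\<lambda>\<omega>. x m \<omega> * x m \<omega>)
      = (\<Sum>g<m. \<Sum>h<m. pmf p (m - g) * pmf p (m - h) * prob (B g \<inter> B h))" for m
  proof -
    have "(\<lambda>\<omega>. x m \<omega> * x m \<omega>)
        = (\<lambda>\<omega>. \<Sum>g<m. \<Sum>h<m. pmf p (m - g) * pmf p (m - h) * indicator (B g \<inter> B h) \<omega>)"
      unfolding x_def ind sum_product
      by (intro ext sum.cong) (auto simp: indicator_def)
    moreover have "integrable M (\<lambda>\<omega>. pmf p (m - g) * pmf p (m - h) * indicator (B g \<inter> B h) \<omega>)"
      for g h
      by (intro integrable_mult_right integrable_real_indicator) (auto simp: less_top[symmetric])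
    ultimately show ?thesis
      by (simp only: Bochner_Integration.integral_sum Bochner_Integration.integrable_sum)
         (simp add: Int_absorb2 sets.sets_into_space)
  qed
  \<comment> \<open>Each weight \<open>Q (m - g)\<close> splits into the probability of a step from
    \<open>m + 1\<close> to \<open>g\<close> and the next tail. The first parts add up to the mean
    of \<open>x (Suc m)\<close>; the new site enters with weight \<open>Q 0 = 1\<close> and, by
    \<open>step\<close>, probability at most the mean of the square.\<close>
  have w_Suc: "w (Suc m) + expectation (y (Suc m)) \<le> w m" if "m \<ge> c" for m
  proof -
    have "w m = (\<Sum>g<Suc m. Q (m - g) * prob (B g))"
      by (simp add: w_def lessThan_Suc_atMost)
    also have "\<dots> = (\<Sum>g<Suc m. pmf p (Suc m - g) * prob (B g) + Q (Suc m - g) * prob (B g))"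
      by (intro sum.cong refl) (simp add: Q_Suc[of "m - _"] Suc_diff_le algebra_simps)
    also have "\<dots> = expectation (x (Suc m)) + (\<Sum>g<Suc m. Q (Suc m - g) * prob (B g))"
      by (simp only: sum.distrib Ex)
    finally have "w m = expectation (x (Suc m)) + (\<Sum>g\<le>m. Q (Suc m - g) * prob (B g))"
      by (simp only: lessThan_Suc_atMost)
    moreover have "w (Suc m) = (\<Sum>g\<le>m. Q (Suc m - g) * prob (B g)) + prob (B (Suc m))"
      by (simp add: w_def Q0)
    moreover have "expectation (y (Suc m))
        = expectation (x (Suc m)) - expectation (\<lambda>\<omega>. x (Suc m) \<omega> * x (Suc m) \<omega>)"
      unfolding y_eq by (intro Bochner_Integration.integral_diff x_int x2_int)
    ultimately show ?thesis
      using step[of "Suc m"] that unfolding Ex2 by simp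
  qed
  have w_sum: "w (c + n) + (\<Sum>m<n. expectation (y (Suc (c + m)))) \<le> w c" for n
    by (induction n) (use w_Suc[of "c + _"] in \<open>auto, smt (verit) le_add1\<close>)
  have Ey_nonneg: "expectation (y m) \<ge> 0" for m
    by (simp add: y_nonneg)
  have w_le: "w (c + n) \<le> w c" for n
    using w_sum[of n] sum_nonneg[of "{..<n}" "\<lambda>m. expectation (y (Suc (c + m)))"] Ey_nonneg
    by fastforce
  have lim: "AE \<omega> in M. (\<lambda>m. y m \<omega>) \<longlonglongrightarrow> 0"
  proof -
    \<comment> \<open>The telescoped decrease cannot exceed \<open>w c\<close>, as \<open>w\<close>
      stays nonnegative. Exchanging sum and integral then makes the series of the \<open>y\<close>
      itself finite almost surely, so its terms vanish in the limit.\<close>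
    have "summable (\<lambda>m. expectation (y (Suc (c + m))))"
      using w_sum w_nonneg Ey_nonneg
      by (intro summableI_nonneg_bounded[where x = "w c"]) (auto, smt (verit))
    then have "(\<Sum>m. ennreal (expectation (y (Suc (c + m))))) \<noteq> \<infinity>"
      using Ey_nonneg by (subst suminf_ennreal2) auto
    also have "(\<Sum>m. ennreal (expectation (y (Suc (c + m)))))
        = (\<integral>\<^sup>+\<omega>. (\<Sum>m. ennreal (y (Suc (c + m)) \<omega>)) \<partial>M)"
      using y_int y_nonneg by (subst nn_integral_suminf) (auto simp: nn_integral_eq_integral)
    finally have "AE \<omega> in M. (\<Sum>m. ennreal (y (Suc (c + m)) \<omega>)) \<noteq> \<infinity>"
      by (intro nn_integral_PInf_AE) auto
    then show ?thesis
    proof eventually_elim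
      case (elim \<omega>)
      then have "summable (\<lambda>m. y (Suc (c + m)) \<omega>)"
        using y_nonneg by (intro summable_suminf_not_top) auto
      then have "(\<lambda>m. y (m + Suc c) \<omega>) \<longlonglongrightarrow> 0"
        using summable_LIMSEQ_zero by (fastforce simp: add.commute)
      then show ?case by (rule LIMSEQ_offset)
    qed
  qed
  \<comment> \<open>This excludes the alternative that all sites from some index on belong to
    \<open>B\<close>.\<close>
  have "AE \<omega> in M. \<exists>m\<ge>N. \<omega> \<notin> B m" for N
  proof -
    define F where "F = {\<omega>\<in>space M. \<forall>m\<ge>N. \<omega> \<in> B m}"
    have [measurable]: "F \<in> events" unfolding F_def by measurable
    have F_le: "prob F \<le> prob (B m)" if "m \<ge> N" for m
      using that by (intro finite_measure_mono) (auto simp: F_def)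
    have bound: "prob F * (\<Sum>j<n. Q j) \<le> w c" for n
    proof -
      \<comment> \<open>With this choice the \<open>n\<close> sites \<open>?m - j\<close> for
        \<open>j < n\<close> all lie beyond \<open>N\<close>, so each has probability at least
        \<open>prob F\<close>, and \<open>w ?m\<close> is still bounded by
        \<open>w c\<close>.\<close>
      let ?m = "c + (N + n)"
      have "prob F * (\<Sum>j<n. Q j) = (\<Sum>j<n. Q j * prob F)"
        by (simp add: sum_distrib_left mult.commute)
      also have "\<dots> \<le> (\<Sum>j<n. Q j * prob (B (?m - j)))"
        by (intro sum_mono mult_left_mono F_le Q_nonneg) auto
      also have "\<dots> = (\<Sum>g\<in>(\<lambda>j. ?m - j) ` {..<n}. Q (?m - g) * prob (B g))"
        by (subst sum.reindex) (auto simp: inj_on_def)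
      also have "\<dots> \<le> w ?m"
        unfolding w_def by (intro sum_mono2 mult_nonneg_nonneg Q_nonneg) auto
      finally show ?thesis using w_le[of "N + n"] by simp
    qed
    have "prob F = 0"
    proof (rule ccontr)
      assume "prob F \<noteq> 0"
      then have pos: "prob F > 0" by (simp add: zero_less_measure_iff)
      have "eventually (\<lambda>n. w c / prob F + 1 \<le> (\<Sum>j<n. Q j)) sequentially"
        using sums_measure_gt_infinite[OF inf] unfolding Q_def filterlim_at_top by blast
      then obtain n where "w c / prob F + 1 \<le> (\<Sum>j<n. Q j)"
        by (auto simp: eventually_sequentially)
      then have "w c / prob F < (\<Sum>j<n. Q j)" by simp
      with pos bound[of n] show False by (simp add: field_simps)
    qed
    then show ?thesis
      by (subst AE_iff_measurable[where N = F])
         (auto simp: F_def emeasure_eq_measure)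
  qed
  then have "AE \<omega> in M. \<forall>N. \<exists>m\<ge>N. \<omega> \<notin> B m" by (simp add: AE_all_countable)
  with lim show ?thesis
  proof eventually_elim
    case (elim \<omega>)
    then show ?case
      unfolding y_def x_def using p12
      by (intro eventually_not_if_step_degenerate[where p = p]) auto
  qed
qed

section \<open>Finite blocks of discrete random variables\<close>

text \<open>A finite product of countable discrete spaces is again discrete, so an arbitrary
  predicate \<open>S\<close> is admissible.\<close>

lemma measurable_restrict_PiM_count_space:
  fixes X :: "'i \<Rightarrow> 'a \<Rightarrow> 'b::countable"
  assumes "finite J" "\<And>i. i \<in> J \<Longrightarrow> X i \<in> measurable M (count_space UNIV)"
  shows "Measurable.pred M (\<lambda>\<omega>. S (\<lambda>i\<in>J. X i \<omega>))"
proof -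
  have "(\<lambda>\<omega>. \<lambda>i\<in>J. X i \<omega>) \<in> measurable M (PiM J (\<lambda>_. count_space UNIV))"
    using assms(2) by (intro measurable_restrict)
  then have "(\<lambda>\<omega>. \<lambda>i\<in>J. X i \<omega>) \<in> measurable M (count_space (PiE J (\<lambda>_. UNIV)))"
    using assms(1) by (subst (asm) count_space_PiM_finite) auto
  then show ?thesis
    by (rule measurable_compose) simp
qed

text \<open>The disjoint blocks \<open>{u}\<close>, \<open>{v}\<close> and \<open>J\<close> of an
  independent family are independent. Below, \<open>u\<close> and \<open>v\<close> are two choices
  made at one time and \<open>J\<close> collects all earlier inputs.\<close>

lemma (in prob_space) indep_vars_prob_two_and_restrict:
  fixes X :: "'i \<Rightarrow> 'a \<Rightarrow> 'b::countable"
  assumes ind: "indep_vars (\<lambda>_. count_space UNIV) X I"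
    and uv: "u \<in> I" "v \<in> I" "u \<noteq> v" "u \<notin> J" "v \<notin> J" and J: "J \<subseteq> I" "finite J"
  shows "prob {\<omega>\<in>space M. X u \<omega> = a \<and> X v \<omega> = b \<and> S (\<lambda>i\<in>J. X i \<omega>)} =
    prob {\<omega>\<in>space M. X u \<omega> = a} * prob {\<omega>\<in>space M. X v \<omega> = b}
      * prob {\<omega>\<in>space M. S (\<lambda>i\<in>J. X i \<omega>)}"
proof -
  define K where "K j = (if j = 0 then {u} else if j = 1 then {v} else J)" for j :: nat
  define A where "A j = {f \<in> PiE (K j) (\<lambda>_. UNIV :: 'b set).
      if j = 0 then f u = a else if j = 1 then f v = b else S f}" for j :: nat
  let ?Y = "\<lambda>j \<omega>. \<lambda>i\<in>K j. X i \<omega>"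
  have "indep_vars (\<lambda>j. PiM (K j) (\<lambda>_. count_space UNIV)) ?Y {0, 1, 2}"
    using uv J by (intro indep_vars_restrict[OF ind]) (auto simp: K_def disjoint_family_on_def)
  then have "prob (\<Inter>j\<in>{0,1,2}. ?Y j -` A j \<inter> space M) = (\<Prod>j\<in>{0,1,2}. prob (?Y j -` A j \<inter> space M))"
  proof (rule indep_varsD)
    fix j :: nat
    have "finite (K j)" using J by (simp add: K_def)
    then show "A j \<in> sets (PiM (K j) (\<lambda>_. count_space UNIV))"
      by (subst count_space_PiM_finite) (auto simp: A_def)
  qed auto
  moreover have "?Y 0 -` A 0 \<inter> space M = {\<omega>\<in>space M. X u \<omega> = a}"
    "?Y 1 -` A 1 \<inter> space M = {\<omega>\<in>space M. X v \<omega> = b}"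
    "?Y 2 -` A 2 \<inter> space M = {\<omega>\<in>space M. S (\<lambda>i\<in>J. X i \<omega>)}"
    by (auto simp: A_def K_def)
  moreover have "(\<Inter>j\<in>{0,1,2}. ?Y j -` A j \<inter> space M) =
      (?Y 0 -` A 0 \<inter> space M) \<inter> (?Y 1 -` A 1 \<inter> space M) \<inter> (?Y 2 -` A 2 \<inter> space M)"
    by auto
  moreover have "{\<omega>\<in>space M. X u \<omega> = a} \<inter> {\<omega>\<in>space M. X v \<omega> = b}
      \<inter> {\<omega>\<in>space M. S (\<lambda>i\<in>J. X i \<omega>)}
    = {\<omega>\<in>space M. X u \<omega> = a \<and> X v \<omega> = b \<and> S (\<lambda>i\<in>J. X i \<omega>)}"
    by auto
  ultimately show ?thesis by simp
qed

section \<open>Confined sites of the k-choice model\<close>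

theorem mainTheorem12:
  fixes M :: "'a measure" and p :: "nat pmf" and k :: nat
    and Zs :: "nat \<Rightarrow> nat \<Rightarrow> 'a \<Rightarrow> nat"
  assumes "prob_space M"
    and "k \<ge> 2"
    and "pmf p 0 = 0"
    and "\<And>i. i \<ge> 1 \<Longrightarrow> pmf p i > 0"
    and "(\<integral>\<^sup>+ x. ennreal (real x) \<partial>measure_pmf p) = \<infinity>"
    and "prob_space.indep_vars M (\<lambda>_. count_space UNIV) (\<lambda>(i, n). Zs i n) ({..<k} \<times> {1..})"
    and "\<And>i n. i < k \<Longrightarrow> n \<ge> 1 \<Longrightarrow> distr M (count_space UNIV) (Zs i n) = measure_pmf p"
  shows "AE \<omega> in M. filterlim (\<lambda>n::nat. Lmin k (\<lambda>i m. Zs i m \<omega>) (int n)) at_bot sequentially"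
proof -
  interpret prob_space M by fact
  have meas[measurable]: "Zs i n \<in> measurable M (count_space UNIV)" if "i < k" "n \<ge> 1" for i n
    using assms(6) that unfolding indep_vars_def by (auto 0 4)
  have prob_Z: "prob {\<omega>\<in>space M. Zs i n \<omega> = a} = pmf p a" if "i < k" "n \<ge> 1" for i n a
  proof -
    have "pmf p a = measure (distr M (count_space UNIV) (Zs i n)) {a}"
      by (simp add: pmf.rep_eq assms(7)[OF that])
    also have "\<dots> = prob (Zs i n -` {a} \<inter> space M)"
      using meas[OF that] by (intro measure_distr) auto
    also have "Zs i n -` {a} \<inter> space M = {\<omega>\<in>space M. Zs i n \<omega> = a}" by auto
    finally show ?thesis by simp
  qed
  \<comment> \<open>Almost surely the positivity guard in \<open>Tset\<close> lets every choice
    through.\<close>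
  have AE_pos: "AE \<omega> in M. \<forall>i m. i < k \<longrightarrow> 1 \<le> m \<longrightarrow> 0 < Zs i m \<omega>"
  proof -
    have "AE \<omega> in M. i < k \<longrightarrow> 1 \<le> m \<longrightarrow> 0 < Zs i m \<omega>" for i m
    proof (cases "i < k \<and> 1 \<le> m")
      case True
      then have [measurable]: "Zs i m \<in> measurable M (count_space UNIV)" by (intro meas) auto
      have "AE \<omega> in M. \<not> Zs i m \<omega> = 0"
        using prob_Z[of i m 0] True assms(3)
        by (subst AE_iff_measurable[where N = "{\<omega>\<in>space M. Zs i m \<omega> = 0}"])
           (auto simp: emeasure_eq_measure)
      then show ?thesis by eventually_elim simp
    qed auto
    then show ?thesis by (simp add: AE_all_countable)
  qed
  define T where "T \<omega> = Tset k (\<lambda>i m. Zs i m \<omega>)" for \<omega>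
  define J where "J n = {..<k} \<times> {1..<n}" for n :: nat
  \<comment> \<open>Outside \<open>J N\<close> the restricted inputs are \<open>undefined\<close>,
    but a tree rooted before time \<open>N\<close> never reads them.\<close>
  have T_restrict: "T \<omega> n = Tset k (\<lambda>i m. (\<lambda>(i, m)\<in>J N. Zs i m \<omega>) (i, m)) n" if "n < int N" for n N \<omega>
    unfolding T_def using that by (intro Tset_cong) (auto simp: J_def)
  have "AE \<omega> in M. eventually (\<lambda>m. \<omega> \<notin> {\<omega>\<in>space M. T \<omega> (int m - int c) \<subseteq> {- int c..}}) sequentially"
    for c
  proof -
    \<comment> \<open>Site \<open>m\<close> stands for the integer m - c. For m \<le> c its tree is
      a singleton inside the bound, so these sites are always confined; the quadratic bound is
      claimed only beyond \<open>c\<close>.\<close>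
    define B where "B m = {\<omega>\<in>space M. T \<omega> (int m - int c) \<subseteq> {- int c..}}" for m
    have restrict_meas: "Measurable.pred M (\<lambda>\<omega>. S (\<lambda>(i, m)\<in>J n. Zs i m \<omega>))"
      for n and S :: "(nat \<times> nat \<Rightarrow> nat) \<Rightarrow> bool"
      using measurable_restrict_PiM_count_space[of "J n" "\<lambda>(i, m). Zs i m" M S] meas
      by (auto simp: J_def case_prod_unfold)
    have B_events[measurable]: "B m \<in> events" for m
    proof -
      define S where "S f \<longleftrightarrow> Tset k (\<lambda>i m. f (i, m)) (int m - int c) \<subseteq> {- int c..}"
        for f :: "nat \<times> nat \<Rightarrow> nat"
      have [measurable]: "Measurable.pred M (\<lambda>\<omega>. S (\<lambda>(i, m)\<in>J (Suc m). Zs i m \<omega>))"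
        by (rule restrict_meas)
      have "B m = {\<omega>\<in>space M. S (\<lambda>(i, m)\<in>J (Suc m). Zs i m \<omega>)}"
        unfolding B_def S_def using T_restrict[of "int m - int c" "Suc m"] by auto
      then show ?thesis by simp
    qed
    have "prob (B m) \<le> (\<Sum>g<m. \<Sum>h<m. pmf p (m - g) * pmf p (m - h) * prob (B g \<inter> B h))"
      if "m > c" for m
    proof -
      define n where "n = m - c"
      have n: "n \<ge> 1" "int m - int c = int n" using that by (auto simp: n_def)
      \<comment> \<open>The first two choices at time \<open>n\<close> lead from site
        \<open>m\<close> to the confined sites \<open>g\<close> and \<open>h\<close>, which may
        coincide.\<close>
      define E where "E g h = {\<omega>\<in>space M. Zs 0 n \<omega> = m - g \<and> Zs 1 n \<omega> = m - h \<and> \<omega> \<in> B g \<inter> B h}"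
        for g h
      have [measurable]: "Zs 0 n \<in> measurable M (count_space UNIV)"
        "Zs 1 n \<in> measurable M (count_space UNIV)"
        using assms(2) n by (auto intro!: meas)
      have E_events[measurable]: "E g h \<in> events" for g h
        unfolding E_def by measurable
      have E_prob: "prob (E g h) = pmf p (m - g) * pmf p (m - h) * prob (B g \<inter> B h)"
        if "g < m" "h < m" for g h
      proof -
        define S where "S f \<longleftrightarrow> Tset k (\<lambda>i m. f (i, m)) (int g - int c) \<subseteq> {- int c..} \<and>
            Tset k (\<lambda>i m. f (i, m)) (int h - int c) \<subseteq> {- int c..}" for f :: "nat \<times> nat \<Rightarrow> nat"
        \<comment> \<open>As \<open>g\<close> and \<open>h\<close> are smaller than
          \<open>m\<close>, their trees are rooted before time \<open>n\<close> and so depend only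
          on inputs independent of the two choices at \<open>n\<close>.\<close>
        have S: "\<omega> \<in> B g \<inter> B h \<longleftrightarrow> \<omega> \<in> space M \<and> S (\<lambda>(i, m)\<in>J n. Zs i m \<omega>)" for \<omega>
          unfolding B_def S_def using T_restrict[of "int g - int c" n \<omega>] T_restrict[of "int h - int c" n \<omega>]
            that n by auto
        have "J n \<subseteq> {..<k} \<times> {1..}" by (auto simp: J_def)
        then have "prob (E g h) = prob {\<omega>\<in>space M. Zs 0 n \<omega> = m - g} * prob {\<omega>\<in>space M. Zs 1 n \<omega> = m - h}
            * prob {\<omega>\<in>space M. S (\<lambda>(i, m)\<in>J n. Zs i m \<omega>)}"
          using indep_vars_prob_two_and_restrict[OF assms(6), of "(0, n)" "(1, n)" "J n" "m - g" "m - h" S]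
            assms(2) n
          unfolding E_def S by (auto simp: J_def case_prod_unfold cong: conj_cong)
        also have "{\<omega>\<in>space M. S (\<lambda>(i, m)\<in>J n. Zs i m \<omega>)} = B g \<inter> B h"
          using S by blast
        finally show ?thesis using prob_Z[of 0 n] prob_Z[of 1 n] assms(2) n by simp
      qed
      \<comment> \<open>The tree of a confined site contains the trees of all its choices, so the
        first two already place it in some \<open>E g h\<close>; a union bound finishes.\<close>
      have "AE \<omega> in M. \<omega> \<in> B m \<longrightarrow> \<omega> \<in> (\<Union>g<m. \<Union>h<m. E g h)"
        using AE_pos
      proof eventually_elim
        case (elim \<omega>)
        show ?case
        proof
          assume B: "\<omega> \<in> B m"
          have ex: "\<exists>g<m. Zs i n \<omega> = m - g \<and> \<omega> \<in> B g" if "i < k" for i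
          proof -
            have "0 < Zs i n \<omega>" using elim that n by auto
            then have "T \<omega> (int n - int (Zs i n \<omega>)) \<subseteq> T \<omega> (int n)"
              unfolding T_def using that n by (subst (2) Tset_pos) auto
            also have "\<dots> \<subseteq> {- int c..}" using B n by (simp add: B_def)
            finally have sub: "T \<omega> (int n - int (Zs i n \<omega>)) \<subseteq> {- int c..}" .
            \<comment> \<open>Every tree contains its root, so the chosen site is not below -c;
              hence the step is at most \<open>m\<close> and the subtraction on the naturals is
              exact.\<close>
            have "int n - int (Zs i n \<omega>) \<in> T \<omega> (int n - int (Zs i n \<omega>))"
              unfolding T_def by (subst Tset.simps) auto
            with sub have le: "Zs i n \<omega> \<le> m" using n by auto
            then have "int n - int (Zs i n \<omega>) = int (m - Zs i n \<omega>) - int c" using n by auto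
            with sub B have "\<omega> \<in> B (m - Zs i n \<omega>)" by (simp add: B_def)
            with le \<open>0 < Zs i n \<omega>\<close> show ?thesis
              by (intro exI[of _ "m - Zs i n \<omega>"]) auto
          qed
          from ex[of 0] ex[of 1] assms(2) B show "\<omega> \<in> (\<Union>g<m. \<Union>h<m. E g h)"
            by (fastforce simp: E_def B_def)
        qed
      qed
      then have "prob (B m) \<le> prob (\<Union>g<m. \<Union>h<m. E g h)"
        by (intro finite_measure_mono_AE) auto
      also have "\<dots> \<le> (\<Sum>g<m. prob (\<Union>h<m. E g h))"
        by (intro finite_measure_subadditive_finite) auto
      also have "\<dots> \<le> (\<Sum>g<m. \<Sum>h<m. prob (E g h))"
        by (intro sum_mono finite_measure_subadditive_finite) auto
      also have "\<dots> = (\<Sum>g<m. \<Sum>h<m. pmf p (m - g) * pmf p (m - h) * prob (B g \<inter> B h))"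
        by (intro sum.cong E_prob refl) auto
      finally show ?thesis .
    qed
    then have "AE \<omega> in M. eventually (\<lambda>m. \<omega> \<notin> B m) sequentially"
      using assms(3,4,5) B_events
      by (intro AE_eventually_not_mem_if_quadratic_bound[where p = p and c = c]) auto
    then show ?thesis unfolding B_def .
  qed
  \<comment> \<open>There are countably many levels \<open>c\<close>, so one null set serves them
    all.\<close>
  then have "AE \<omega> in M. \<forall>c. eventually (\<lambda>m. \<omega> \<notin> {\<omega>\<in>space M. T \<omega> (int m - int c) \<subseteq> {- int c..}}) sequentially"
    by (simp add: AE_all_countable)
  with AE_space show ?thesis
  proof eventually_elim
    case (elim \<omega>)
    show ?case
      unfolding filterlim_at_bot
    proof
      fix C :: int
      \<comment> \<open>Then -c \<le> C also when \<open>C\<close> is positive, where c = 0.\<close>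
      define c where "c = nat (- C)"
      \<comment> \<open>Replacing the index by \<open>n + c\<close> undoes the shift of the
        sites.\<close>
      have "eventually (\<lambda>n. \<not> T \<omega> (int (n + c) - int c) \<subseteq> {- int c..}) sequentially"
        using elim by (subst eventually_sequentially_seg) auto
      then show "eventually (\<lambda>n. Lmin k (\<lambda>i m. Zs i m \<omega>) (int n) \<le> C) sequentially"
      proof eventually_elim
        case (elim n)
        have "\<not> - int c \<le> Lmin k (\<lambda>i m. Zs i m \<omega>) (int n)"
        proof
          assume "- int c \<le> Lmin k (\<lambda>i m. Zs i m \<omega>) (int n)"
          then have "T \<omega> (int n) \<subseteq> {- int c..}"
            unfolding T_def by (intro Tset_subset_if_Lmin_ge) auto
          with elim show False by simp
        qed
        then show ?case by (simp add: c_def split: if_splits)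
      qed
    qed
  qed
qed

end
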